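(* Let $a,b$ be positive integers with $a<b$, and let $\kappa=b-a$. Let $n\ge 0$ be an integer, let $G=\mathcal{T}_\kappa(n;a,b)$, and let $t=n\bmod(b+1)$ with $0\le t\le b$. Then $G=\mathcal{T}_\kappa(t;a,b)$.
   Context: Games are short two-player combinatorial games (players Left and Right) under normal play: a player unable to move on their turn loses. Truncated Support (TS): for positive integers $a<b$ and an integer truncation level $\tau$ with $1\le\tau<b$, and a heap size $n\ge0$, $\mathcal{T}_\tau(n;a,b)$ is the game played on one heap of $n$ pebbles in which Left, on her turn, may remove any number $i\in\{1,\dots,a\}$ of pebbles with $i\le n$, and Right, on his turn, may remove any number $j\in\{\tau+1,\dots,b\}$ with $j\le n$. Equality $G=H$ is equality of game values: $G=H$ iff the disjunctive sum $G-H$ is a win for the second player. Equivalently, $G$ and $H$ have the same canonical form. *)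

theory Defs
  imports "HOL-Library.FSet"
begin

text \<open>Short games: every position has finitely many options, and since the datatype is
  inductive, every play ends.\<close>

datatype game = Game (left_opts: "game fset") (right_opts: "game fset")

datatype player = Left | Right

fun opponent :: "player \<Rightarrow> player" where
  "opponent Left = Right"
| "opponent Right = Left"

fun opts :: "player \<Rightarrow> game \<Rightarrow> game fset" where
  "opts Left G = left_opts G"
| "opts Right G = right_opts G"

lemma size_left_opts [termination_simp]:
  assumes "H |\<in>| left_opts G"
  shows "size H < size G"
proof (cases G)
  case (Game L R)
  then have "Suc (size H) \<le> (\<Sum>x\<in>fset L. Suc (size x))"
    using assms by (intro member_le_sum[of H "fset L" "\<lambda>x. Suc (size x)"]) auto
  then show ?thesis using Game by simp
qed

lemma size_right_opts [termination_simp]: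
  assumes "H |\<in>| right_opts G"
  shows "size H < size G"
proof (cases G)
  case (Game L R)
  then have "Suc (size H) \<le> (\<Sum>x\<in>fset R. Suc (size x))"
    using assms by (intro member_le_sum[of H "fset R" "\<lambda>x. Suc (size x)"]) auto
  then show ?thesis using Game by simp
qed

lemma size_opts [termination_simp]: "H |\<in>| opts p G \<Longrightarrow> size H < size G"
  by (cases p) (auto intro: size_left_opts size_right_opts)

text \<open>Normal play: the player to move wins iff some move leads to a position from which the
  opponent, now to move, does not win. In particular a player without options loses.\<close>

fun wins_moving_first :: "player \<Rightarrow> game \<Rightarrow> bool" where
  "wins_moving_first p G \<longleftrightarrow> (\<exists>H |\<in>| opts p G. \<not> wins_moving_first (opponent p) H)"

declare wins_moving_first.simps [simp del]

definition second_player_wins :: "game \<Rightarrow> bool" where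
  "second_player_wins G \<longleftrightarrow> (\<forall>p. \<not> wins_moving_first p G)"

lemma fimage_cong_fundef [fundef_cong]:
  "A = B \<Longrightarrow> (\<And>x. x |\<in>| B \<Longrightarrow> f x = g x) \<Longrightarrow> f |`| A = g |`| B"
  by (rule fset.map_cong)

text \<open>The negative swaps the roles of the two players throughout.\<close>

fun game_neg :: "game \<Rightarrow> game" where
  "game_neg G = Game (game_neg |`| right_opts G) (game_neg |`| left_opts G)"

declare game_neg.simps [simp del]

text \<open>Disjunctive sum: a move consists of moving in exactly one of the two components.\<close>

fun game_sum :: "game \<Rightarrow> game \<Rightarrow> game" where
  "game_sum G H = Game
     ((\<lambda>G'. game_sum G' H) |`| left_opts G |\<union>| (\<lambda>H'. game_sum G H') |`| left_opts H)
     ((\<lambda>G'. game_sum G' H) |`| right_opts G |\<union>| (\<lambda>H'. game_sum G H') |`| right_opts H)"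

declare game_sum.simps [simp del]

definition game_diff :: "game \<Rightarrow> game \<Rightarrow> game" where
  "game_diff G H = game_sum G (game_neg H)"

text \<open>Equality of game values; HOL equality on \<^typ>\<open>game\<close> is identity of game trees.\<close>

definition game_eq :: "game \<Rightarrow> game \<Rightarrow> bool"  (infix "\<doteq>" 50) where
  "G \<doteq> H \<longleftrightarrow> second_player_wins (game_diff G H)"

text \<open>\<open>TS \<tau> n a b\<close> is the truncated support game on a heap of \<open>n\<close> pebbles.\<close>

function TS :: "nat \<Rightarrow> nat \<Rightarrow> nat \<Rightarrow> nat \<Rightarrow> game" where
  "TS \<tau> n a b = Game
     ((\<lambda>i. TS \<tau> (n - i) a b) |`| ffilter (\<lambda>i. i \<le> n) (fset_of_list [1..<a + 1]))
     ((\<lambda>j. TS \<tau> (n - j) a b) |`| ffilter (\<lambda>j. j \<le> n) (fset_of_list [\<tau> + 1..<b + 1]))"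
  by pat_completeness auto
termination
  by (relation "measure (\<lambda>(\<tau>, n, a, b). n)") (auto simp: fset_of_list.rep_eq)

declare TS.simps [simp del]

lemma fset_left_opts_TS:
  "fset (left_opts (TS \<tau> n a b)) = {TS \<tau> (n - i) a b | i. i \<in> {1..a} \<and> i \<le> n}"
  by (subst TS.simps) (auto simp: fset_of_list.rep_eq)

lemma fset_right_opts_TS:
  "fset (right_opts (TS \<tau> n a b)) = {TS \<tau> (n - j) a b | j. j \<in> {\<tau> + 1..b} \<and> j \<le> n}"
  by (subst TS.simps) (auto simp: fset_of_list.rep_eq)

end

theory Submission
  imports Defs
begin

text \<open>
  With \<open>\<kappa> = b - a\<close> the two sets of removals are \<open>{1..a}\<close> and \<open>{b + 1 - a..b}\<close>, and
  \<open>r \<mapsto> b + 1 - r\<close> exchanges them. Hence in a heap of at least \<open>b + 1\<close> pebbles any removal by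
  one player can be completed by the other to a removal of exactly \<open>b + 1\<close> pebbles.

  This decides the difference of a heap of \<open>m + k * (b + 1)\<close> pebbles and one of \<open>m\<close>
  pebbles in favour of the second player. A move in the smaller heap is copied in the larger one,
  which lowers \<open>m\<close> and keeps \<open>k\<close>. A move in the larger heap is completed to \<open>b + 1\<close> within that
  heap when \<open>k > 0\<close>, which lowers \<open>k\<close> and keeps \<open>m\<close>; when \<open>k = 0\<close> the heaps are
  equal and it is copied too. Every reply thus leads to a difference of the same shape, and
  induction on \<open>m + k\<close> applies.
\<close>

lemma opts_game_diff:
  "opts p (game_diff G H) =
     (\<lambda>G'. game_diff G' H) |`| opts p G |\<union>| game_diff G |`| opts (opponent p) H"
proof -
  have neg: "opts p (game_neg H) = game_neg |`| opts (opponent p) H"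
    by (cases p) (simp_all add: game_neg.simps[of H])
  show ?thesis
    unfolding game_diff_def
    by (subst game_sum.simps) (use neg in \<open>cases p; simp add: fset.map_comp comp_def\<close>)
qed

text \<open>A player's moves in the subtracted game are the opponent's moves in the game itself. So when
  a move is copied from one side of the difference to the other, both moves are moves of the same
  player \<open>q\<close> in \<open>G\<close> and in \<open>H\<close>, although different players make them in the difference.\<close>

lemma game_eq_by_replies:
  assumes minuend: "\<And>q G'. G' |\<in>| opts q G \<Longrightarrow>
      (\<exists>G'' |\<in>| opts (opponent q) G'. G'' \<doteq> H) \<or> (\<exists>H' |\<in>| opts q H. G' \<doteq> H')"
    and subtrahend: "\<And>q H'. H' |\<in>| opts q H \<Longrightarrow> \<exists>G' |\<in>| opts q G. G' \<doteq> H'"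
  shows "G \<doteq> H"
proof -
  have opponent_opponent: "opponent (opponent p) = p" for p
    by (cases p) auto
  have "\<not> wins_moving_first p (game_diff G H)" for p
  proof -
    have "wins_moving_first (opponent p) D" if D: "D |\<in>| opts p (game_diff G H)" for D
    proof -
      have "\<exists>E |\<in>| opts (opponent p) D. second_player_wins E"
        using D minuend[of _ p] subtrahend[of _ "opponent p"]
        by (fastforce simp: opts_game_diff opponent_opponent game_eq_def)
      then show ?thesis
        by (subst wins_moving_first.simps) (auto simp: second_player_wins_def)
    qed
    then show ?thesis
      by (subst wins_moving_first.simps) blast
  qed
  then show ?thesis
    by (simp add: game_eq_def second_player_wins_def)
qed

fun removals :: "nat \<Rightarrow> nat \<Rightarrow> nat \<Rightarrow> player \<Rightarrow> nat set" where
  "removals \<tau> a b Left = {1..a}"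
| "removals \<tau> a b Right = {\<tau> + 1..b}"

lemma in_opts_TS_iff:
  "G' |\<in>| opts p (TS \<tau> n a b) \<longleftrightarrow> (\<exists>r \<in> removals \<tau> a b p. r \<le> n \<and> G' = TS \<tau> (n - r) a b)"
  by (cases p) (auto simp: fset_left_opts_TS fset_right_opts_TS)

lemma complement_in_removals:
  assumes "a \<le> b" and "r \<in> removals (b - a) a b p"
  shows "r \<le> b" and "b + 1 - r \<in> removals (b - a) a b (opponent p)"
  using assms by (cases p; auto)+

text \<open>The multiple \<open>k\<close> is arbitrary, since copying keeps it while completing a removal to \<open>b + 1\<close>
  lowers it.\<close>

lemma TS_add_multiple:
  assumes "a \<le> b"
  shows "TS (b - a) (m + k * (b + 1)) a b \<doteq> TS (b - a) m a b"
proof (induction "m + k" arbitrary: m k rule: less_induct)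
  case less
  let ?T = "\<lambda>n. TS (b - a) n a b"
  let ?R = "removals (b - a) a b"
  have pos: "0 < r" if "r \<in> ?R q" for r q
    using that by (cases q) auto
  show ?case
  proof (rule game_eq_by_replies)
    fix q G' assume "G' |\<in>| opts q (?T (m + k * (b + 1)))"
    then obtain r where r: "r \<in> ?R q" "r \<le> m + k * (b + 1)"
      and G': "G' = ?T (m + k * (b + 1) - r)"
      by (auto simp: in_opts_TS_iff)
    show "(\<exists>G'' |\<in>| opts (opponent q) G'. G'' \<doteq> ?T m) \<or> (\<exists>H' |\<in>| opts q (?T m). G' \<doteq> H')"
    proof (cases k)
      case 0
      have "?T (m - r) \<doteq> ?T (m - r)"
        using less[of "m - r" 0] r pos 0 by fastforce
      moreover have "?T (m - r) |\<in>| opts q (?T m)"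
        using r 0 by (auto simp: in_opts_TS_iff)
      ultimately show ?thesis
        using G' 0 by auto
    next
      case (Suc k')
      have "?T (m + k' * (b + 1)) \<doteq> ?T m"
        using less[of m k'] Suc by simp
      moreover have "?T (m + k' * (b + 1)) |\<in>| opts (opponent q) G'"
        unfolding G' in_opts_TS_iff
        using complement_in_removals[OF assms r(1)] Suc
        by (intro bexI[of _ "b + 1 - r"]) auto
      ultimately show ?thesis by blast
    qed
  next
    fix q H' assume "H' |\<in>| opts q (?T m)"
    then obtain r where r: "r \<in> ?R q" "r \<le> m" and H': "H' = ?T (m - r)"
      by (auto simp: in_opts_TS_iff)
    have "?T (m - r + k * (b + 1)) \<doteq> H'"
      unfolding H' using less[of "m - r" k] r pos by fastforce
    moreover have "?T (m - r + k * (b + 1)) |\<in>| opts q (?T (m + k * (b + 1)))"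
      unfolding in_opts_TS_iff using r by (intro bexI[of _ r]) auto
    ultimately show "\<exists>G' |\<in>| opts q (?T (m + k * (b + 1))). G' \<doteq> H'" by blast
  qed
qed

theorem theorem4:
  fixes a b n \<kappa> t :: nat
  assumes "0 < a" and "a < b"
    and "\<kappa> = b - a"
    and "t = n mod (b + 1)"
  shows "TS \<kappa> n a b \<doteq> TS \<kappa> t a b"
proof -
  have "n = t + n div (b + 1) * (b + 1)"
    unfolding assms(4) by (rule mod_div_mult_eq[symmetric])
  then show ?thesis
    using TS_add_multiple[of a b t "n div (b + 1)"] assms(2,3) by simp
qed

end
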